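(* Let $a_1a_2\cdots = 31232\,1\,2\,31232\,2\,1\,2\,31232\,1\,2\,31232\,2\,2\cdots$ be the fixed point starting with $3$ of the morphism $\sigma_2$ on words over $\{1,2,3\}$ given by $$\sigma_2:\ 3\mapsto 31232,\quad 2\mapsto 2,\quad 1\mapsto 1.$$ Then there exists a real number $\beta>1$ such that $a_1a_2\cdots$ is the $(-\beta)$-expansion of $\tfrac{-\beta}{\beta+1}$, and (for this $\beta$) the set $\mathbb{Z}_{-\beta}$ is not relatively dense.
   Context: For real $\beta>1$, the $(-\beta)$-transformation is $T_{-\beta}:\big[\tfrac{-\beta}{\beta+1},\tfrac{1}{\beta+1}\big)\to\big[\tfrac{-\beta}{\beta+1},\tfrac{1}{\beta+1}\big)$, $x\mapsto -\beta x-\big\lfloor \tfrac{\beta}{\beta+1}-\beta x\big\rfloor$. The set of $(-\beta)$-integers is $\mathbb{Z}_{-\beta}=\bigcup_{n\ge0}(-\beta)^n\,T_{-\beta}^{-n}(0)$, where $T_{-\beta}^{-n}(0)$ is the preimage of $0$ under the $n$-th iterate. With $t_n=T_{-\beta}^n\big(\tfrac{-\beta}{\beta+1}\big)$ for $n\ge0$, the $(-\beta)$-expansion of $\tfrac{-\beta}{\beta+1}$ is the sequence $a_1a_2\cdots$ given by $a_n=\big\lfloor \tfrac{\beta}{\beta+1}-\beta t_{n-1}\big\rfloor$, $n\ge1$. A set $S\subset\mathbb{R}$ is relatively dense if there is $R>0$ such that every interval of length $R$ contains at least one point of $S$. A morphism satisfies $\sigma(vw)=\sigma(v)\sigma(w)$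 and is extended to right-infinite words letter by letter. *)

theory Defs
  imports Complex_Main "HOL-Library.Stream"
begin

definition neg_beta_dom :: "real \<Rightarrow> real set" where
  "neg_beta_dom \<beta> = {- \<beta> / (\<beta> + 1) ..< 1 / (\<beta> + 1)}"

text \<open>The transformation is a total function here; it is only meaningful on
  \<^const>\<open>neg_beta_dom\<close>, which it maps to itself.\<close>

definition neg_beta_T :: "real \<Rightarrow> real \<Rightarrow> real" where
  "neg_beta_T \<beta> x = - \<beta> * x - of_int \<lfloor>\<beta> / (\<beta> + 1) - \<beta> * x\<rfloor>"

lemma neg_beta_T_in_dom:
  assumes "\<beta> > 1"
  shows "neg_beta_T \<beta> x \<in> neg_beta_dom \<beta>"
proof -
  let ?y = "\<beta> / (\<beta> + 1) - \<beta> * x"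
  have "1 - \<beta> / (\<beta> + 1) = 1 / (\<beta> + 1)"
    using assms by (simp add: field_simps)
  moreover have "of_int \<lfloor>?y\<rfloor> \<le> ?y" "?y < of_int \<lfloor>?y\<rfloor> + 1"
    by linarith+
  ultimately show ?thesis
    unfolding neg_beta_T_def neg_beta_dom_def atLeastLessThan_iff
      minus_divide_left[symmetric] minus_mult_left[symmetric]
    by linarith
qed

text \<open>The digit at 0-based position \<open>n\<close> is computed from the \<open>n\<close>-th iterate, so
  \<open>neg_beta_expansion \<beta> x !! (n - 1)\<close> is the usual \<open>n\<close>-th digit for \<open>n \<ge> 1\<close>.\<close>

definition neg_beta_expansion :: "real \<Rightarrow> real \<Rightarrow> int stream" where
  "neg_beta_expansion \<beta> x =
     smap (\<lambda>t. \<lfloor>\<beta> / (\<beta> + 1) - \<beta> * t\<rfloor>) (siterate (neg_beta_T \<beta>) x)"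

definition neg_beta_integers :: "real \<Rightarrow> real set" where
  "neg_beta_integers \<beta> =
     (\<Union>n. (\<lambda>x. (- \<beta>) ^ n * x) ` {x \<in> neg_beta_dom \<beta>. (neg_beta_T \<beta> ^^ n) x = 0})"

definition relatively_dense :: "real set \<Rightarrow> bool" where
  "relatively_dense S \<longleftrightarrow> (\<exists>R>0. \<forall>x. {x..x + R} \<inter> S \<noteq> {})"

text \<open>A morphism is given by its images of letters. The stream version concatenates the
  images of the letters; \<^const>\<open>flat\<close> does this correctly when no letter is erased.\<close>

definition morphism_word :: "('a \<Rightarrow> 'b list) \<Rightarrow> 'a list \<Rightarrow> 'b list" where
  "morphism_word \<sigma> w = concat (map \<sigma> w)"

definition morphism_stream :: "('a \<Rightarrow> 'b list) \<Rightarrow> 'a stream \<Rightarrow> 'b stream" where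
  "morphism_stream \<sigma> w = flat (smap \<sigma> w)"

text \<open>Only the values at the letters 1, 2 and 3 matter.\<close>

definition sigma2 :: "int \<Rightarrow> int list" where
  "sigma2 l = (if l = 3 then [3, 1, 2, 3, 2] else [l])"

definition sigma2_fixed_point :: "int stream \<Rightarrow> bool" where
  "sigma2_fixed_point a \<longleftrightarrow>
     sset a \<subseteq> {1, 2, 3} \<and> shd a = 3 \<and> morphism_stream sigma2 a = a"

lemma morphism_word_append:
  "morphism_word \<sigma> (v @ w) = morphism_word \<sigma> v @ morphism_word \<sigma> w"
  by (simp add: morphism_word_def)

lemma morphism_stream_shift:
  assumes "\<And>l. \<sigma> l \<noteq> []"
  shows "morphism_stream \<sigma> (w @- s) = morphism_word \<sigma> w @- morphism_stream \<sigma> s"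
  by (induction w) (simp_all add: morphism_word_def morphism_stream_def assms)

definition sigma2_pow :: "nat \<Rightarrow> int list" where
  "sigma2_pow k = (morphism_word sigma2 ^^ k) [3]"

lemma sigma2_pow_0 [simp]: "sigma2_pow 0 = [3]"
  by (simp add: sigma2_pow_def)

lemma sigma2_pow_Suc: "sigma2_pow (Suc k) = morphism_word sigma2 (sigma2_pow k)"
  by (simp add: sigma2_pow_def)

lemma sigma2_nonempty [simp]: "sigma2 l \<noteq> []"
  by (simp add: sigma2_def)

lemma sigma2_pow_prefix: "\<exists>v. v \<noteq> [] \<and> sigma2_pow (Suc k) = sigma2_pow k @ v"
proof (induction k)
  case 0
  show ?case
    by (simp add: sigma2_pow_Suc morphism_word_def sigma2_def)
next
  case (Suc k)
  then obtain v where v: "v \<noteq> []" "sigma2_pow (Suc k) = sigma2_pow k @ v"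
    by blast
  have "morphism_word sigma2 v \<noteq> []"
    using v(1) by (cases v) (auto simp: morphism_word_def)
  moreover have "sigma2_pow (Suc (Suc k)) = sigma2_pow (Suc k) @ morphism_word sigma2 v"
    by (metis sigma2_pow_Suc v(2) morphism_word_append)
  ultimately show ?case
    by blast
qed

lemma length_sigma2_pow: "k < length (sigma2_pow k)"
proof (induction k)
  case (Suc k)
  then show ?case
    using sigma2_pow_prefix[of k] by (auto simp: Suc_le_eq neq_Nil_conv)
qed simp

lemma sigma2_pow_prefix_le:
  assumes "j \<le> k"
  shows "\<exists>v. sigma2_pow k = sigma2_pow j @ v"
  using assms
proof (induction k rule: dec_induct)
  case (step k)
  then show ?case
    using sigma2_pow_prefix[of k] by auto
qed simp

lemma sigma2_pow_nth:
  assumes "i < length (sigma2_pow j)" "i < length (sigma2_pow k)"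
  shows "sigma2_pow j ! i = sigma2_pow k ! i"
proof (cases "j \<le> k")
  case True
  then show ?thesis
    using sigma2_pow_prefix_le[of j k] assms by (auto simp: nth_append)
next
  case False
  then show ?thesis
    using sigma2_pow_prefix_le[of k j] assms by (auto simp: nth_append)
qed

lemma set_sigma2_pow: "set (sigma2_pow k) \<subseteq> {1, 2, 3}"
proof (induction k)
  case (Suc k)
  then show ?case
    by (auto simp: sigma2_pow_Suc morphism_word_def sigma2_def split: if_splits)
qed simp

definition sigma2_limit :: "int stream" where
  "sigma2_limit = smap (\<lambda>i. sigma2_pow i ! i) nats"

lemma sigma2_limit_prefix: "stake (length (sigma2_pow k)) sigma2_limit = sigma2_pow k"
  by (rule nth_equalityI)
     (auto simp: sigma2_limit_def intro: sigma2_pow_nth length_sigma2_pow)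

lemma eq_sigma2_limit:
  assumes "\<And>k. \<exists>s. a = sigma2_pow k @- s"
  shows "a = sigma2_limit"
proof -
  have "a !! i = sigma2_limit !! i" for i
  proof -
    obtain s where "a = sigma2_pow i @- s"
      using assms by blast
    then show ?thesis
      by (simp add: sigma2_limit_def length_sigma2_pow)
  qed
  then show ?thesis
    by (metis smap_alt stream.map_id0 id_apply)
qed

lemma sigma2_limit_fixed_point: "sigma2_fixed_point sigma2_limit"
proof -
  have "\<exists>s. morphism_stream sigma2 sigma2_limit = sigma2_pow k @- s" for k
  proof -
    obtain v where v: "sigma2_pow (Suc k) = sigma2_pow k @ v"
      using sigma2_pow_prefix by blast
    have "sigma2_limit = sigma2_pow k @- sdrop (length (sigma2_pow k)) sigma2_limit"
      by (metis sigma2_limit_prefix stake_sdrop)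
    then have "morphism_stream sigma2 sigma2_limit =
        sigma2_pow (Suc k) @-
          morphism_stream sigma2 (sdrop (length (sigma2_pow k)) sigma2_limit)"
      by (metis morphism_stream_shift sigma2_nonempty sigma2_pow_Suc)
    then show ?thesis
      by (auto simp: v)
  qed
  then have "morphism_stream sigma2 sigma2_limit = sigma2_limit"
    by (rule eq_sigma2_limit)
  moreover have "shd sigma2_limit = 3"
    by (simp add: sigma2_limit_def)
  moreover have "sigma2_pow i ! i \<in> {1, 2, 3}" for i
    using set_sigma2_pow length_sigma2_pow nth_mem by blast
  then have "sset sigma2_limit \<subseteq> {1, 2, 3}"
    by (auto simp: sigma2_limit_def sset_range)
  ultimately show ?thesis
    by (simp add: sigma2_fixed_point_def)
qed

lemma sigma2_fixed_point_prefix: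
  assumes "sigma2_fixed_point a"
  shows "\<exists>s. a = sigma2_pow k @- s"
proof (induction k)
  case 0
  have "a = 3 ## stl a"
    using assms by (metis sigma2_fixed_point_def stream.collapse)
  then show ?case
    by auto
next
  case (Suc k)
  then obtain s where "a = sigma2_pow k @- s"
    by blast
  then have "morphism_stream sigma2 a = sigma2_pow (Suc k) @- morphism_stream sigma2 s"
    by (simp add: morphism_stream_shift sigma2_pow_Suc)
  then show ?case
    using assms by (auto simp: sigma2_fixed_point_def)
qed

lemma ex1_sigma2_fixed_point: "\<exists>!a. sigma2_fixed_point a"
  by (metis eq_sigma2_limit sigma2_fixed_point_prefix sigma2_limit_fixed_point)

end

theory Submission
  imports Defs
begin

text \<open>A base \<open>\<beta> \<in> (3, 4]\<close> with \<open>- \<beta> / (\<beta> + 1) = \<Sum>\<^sub>k a\<^sub>k (- \<beta>)\<^sup>-\<^sup>k\<close> exists by the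
  intermediate value theorem. As \<open>\<beta> > 3\<close> and the digits are 1, 2 and 3, values are
  compared like digit sequences in the alternating lexicographic order. The morphism preserves this
  order, since its images have odd length and start with the letter itself. So \<open>a\<close> is the least
  of its suffixes, and the value \<open>t n\<close> of every suffix lies in \<open>[t 0, 0)\<close>.

  Let \<open>W\<close> be the image of 3 under the \<open>k\<close>-th power of the morphism and \<open>p\<close> its odd length; the next power
  gives \<open>W 1 2 W 2\<close>. Close to the right end \<open>t 0 + 1\<close> of the domain, the iterate with index \<open>p + 3\<close>
  has an affine piece running from \<open>t (p + 2)\<close> to \<open>t 0\<close>, followed by a jump back to \<open>t 0 + 1\<close>.
  Since \<open>W\<close> is a prefix of both suffixes, \<open>p\<close> further steps map the first piece into an interval between
  the negative numbers \<open>t p\<close> and \<open>t (2 p + 2)\<close>, whose distance is bounded below, while behind the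
  jump the situation for \<open>k\<close> repeats. Hence the part next to the right end on which the iterate
  of index \<open>p\<close> has no zero has, scaled by \<open>\<beta>\<^sup>p\<close>, a length that grows linearly in \<open>k\<close>.\<close>

section \<open>Prefixes of the fixed point\<close>

text \<open>The letters 1 and 2 are fixed by the morphism, so it maps the decomposition for
  \<open>k\<close> to the one for \<open>k + 1\<close>.\<close>

lemma sigma2_pow_Suc_eq:
  "sigma2_pow (Suc k) = sigma2_pow k @ [1, 2] @ sigma2_pow k @ [2]"
proof (induction k)
  case 0
  show ?case
    by (simp add: sigma2_pow_Suc morphism_word_def sigma2_def)
next
  case (Suc k)
  have "sigma2_pow (Suc (Suc k)) = morphism_word sigma2 (sigma2_pow k @ [1, 2] @ sigma2_pow k @ [2])"
    by (metis Suc sigma2_pow_Suc)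
  also have "\<dots> = sigma2_pow (Suc k) @ [1, 2] @ sigma2_pow (Suc k) @ [2]"
    unfolding morphism_word_append sigma2_pow_Suc[symmetric]
    by (simp add: morphism_word_def sigma2_def)
  finally show ?case .
qed

lemma odd_length_sigma2_pow: "odd (length (sigma2_pow k))"
  by (induction k) (simp_all add: sigma2_pow_Suc_eq)

lemma sigma2_fixed_point_snth:
  assumes "sigma2_fixed_point a" and p: "p = length (sigma2_pow k)"
  shows "i < p \<Longrightarrow> a !! (p + 2 + i) = a !! i" "a !! p = 1" "a !! (p + 1) = 2" "a !! (2 * p + 2) = 2"
proof -
  obtain s where s: "a = sigma2_pow (Suc k) @- s"
    using sigma2_fixed_point_prefix assms(1) by blast
  define W where "W = sigma2_pow k"
  have a: "a = (W @ [1, 2] @ W @ [2]) @- s"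
    using s unfolding W_def sigma2_pow_Suc_eq .
  have pre: "a !! i = (W @ [1, 2] @ W @ [2]) ! i" if "i < 2 * p + 3" for i
    unfolding a using that by (intro shift_snth_less) (simp add: p W_def)
  show "i < p \<Longrightarrow> a !! (p + 2 + i) = a !! i" "a !! p = 1" "a !! (p + 1) = 2" "a !! (2 * p + 2) = 2"
    by (simp_all add: pre p W_def nth_append del: snth.simps)
qed

section \<open>Digits and inverse branches of the transformation\<close>

text \<open>The domain is half-open of length 1, so only one integer \<open>d\<close> can bring the
  image back into it. A digit can thus be guessed and checked instead of evaluating the
  floor.\<close>

lemma neg_beta_T_eq:
  assumes "-\<beta> * x - of_int d \<in> neg_beta_dom \<beta>" "\<beta> > 1"
  shows "neg_beta_T \<beta> x = -\<beta> * x - of_int d" "\<lfloor>\<beta> / (\<beta> + 1) - \<beta> * x\<rfloor> = d"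
proof -
  have "1 / (\<beta> + 1) = 1 - \<beta> / (\<beta> + 1)"
    using assms(2) by (simp add: field_simps)
  then show "\<lfloor>\<beta> / (\<beta> + 1) - \<beta> * x\<rfloor> = d"
    using assms(1) by (auto simp: neg_beta_dom_def floor_eq_iff minus_divide_left[symmetric])
  then show "neg_beta_T \<beta> x = -\<beta> * x - of_int d"
    by (simp add: neg_beta_T_def)
qed

text \<open>Division by \<open>- \<beta>\<close> maps the open domain into itself and is undone by a
  step with digit 0. The left end is excluded because it would go to the right end, which lies
  outside the domain.\<close>

lemma neg_beta_T_pow_divide:
  assumes "\<beta> > 1" "- \<beta> / (\<beta> + 1) < y" "y < 1 / (\<beta> + 1)"
  shows "(neg_beta_T \<beta> ^^ j) (y / (-\<beta>) ^ j) = y"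
proof -
  have "(neg_beta_T \<beta> ^^ j) (y / (-\<beta>) ^ j) = y \<and>
      - \<beta> / (\<beta> + 1) < y / (-\<beta>) ^ j \<and> y / (-\<beta>) ^ j < 1 / (\<beta> + 1)"
  proof (induction j)
    case 0
    then show ?case using assms by simp
  next
    case (Suc j)
    define z where "z = y / (-\<beta>) ^ j"
    have z: "- \<beta> / (\<beta> + 1) < z" "z < 1 / (\<beta> + 1)"
      using Suc by (auto simp: z_def)
    have eq: "y / (-\<beta>) ^ Suc j = - z / \<beta>"
      using assms by (simp add: z_def)
    have "neg_beta_T \<beta> (- z / \<beta>) = z"
      using neg_beta_T_eq(1)[of \<beta> "- z / \<beta>" 0] z assms(1) by (simp add: neg_beta_dom_def)
    moreover have "- z / \<beta> < 1 / (\<beta> + 1)"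
      using z(1) assms(1) by (simp add: field_simps)
    moreover have "- \<beta> / (\<beta> + 1) < - z / \<beta>"
    proof -
      have "\<beta> * \<beta> > 1 * 1"
        using assms(1) by (intro mult_strict_mono) auto
      moreover have "z * (\<beta> + 1) < 1"
        using z(2) assms(1) by (simp add: field_simps)
      ultimately show ?thesis
        using assms(1) by (simp add: field_simps)
    qed
    ultimately show ?case
      using Suc unfolding eq funpow_Suc_right by (simp add: z_def)
  qed
  then show ?thesis by blast
qed

section \<open>The orbit of the left end\<close>

text \<open>\<open>t n\<close> stands for the value of the suffix of \<open>a\<close> at position
  \<open>n\<close>. The last two assumptions come from the order on suffixes; they keep every
  \<open>t n\<close> in the domain, so that these values form the orbit of
  \<open>t 0\<close>.\<close>

locale sigma2_orbit =
  fixes \<beta> :: real and a :: "int stream" and t :: "nat \<Rightarrow> real"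
  assumes beta: "\<beta> > 3"
    and fixed: "sigma2_fixed_point a"
    and t_0: "t 0 = - \<beta> / (\<beta> + 1)"
    and t_Suc: "t (Suc n) = - \<beta> * t n - of_int (a !! n)"
    and t_ge: "t 0 \<le> t n"
    and t_neg: "t n < 0"
begin

abbreviation T where "T \<equiv> neg_beta_T \<beta>"

definition p :: "nat \<Rightarrow> nat" where "p k = length (sigma2_pow k)"

lemmas digits = sigma2_fixed_point_snth[OF fixed p_def]

lemma p_0: "p 0 = 1" and p_Suc: "p (Suc k) = 2 * p k + 3"
  by (simp_all add: p_def sigma2_pow_Suc_eq)

lemma odd_p: "odd (p k)"
  by (simp add: p_def odd_length_sigma2_pow)

lemma minus_power_p [simp]: "(- \<beta>) ^ p k = - (\<beta> ^ p k)"
  using odd_p by simp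

lemma power_p_Suc: "\<beta> ^ p (Suc k) = \<beta> * \<beta> * \<beta> * (\<beta> ^ p k * \<beta> ^ p k)"
  unfolding p_Suc mult_2 power_add by (simp add: numeral_3_eq_3)

lemma p_gt: "k < p k"
  by (simp add: p_def length_sigma2_pow)

lemma right_end: "1 / (\<beta> + 1) = t 0 + 1"
  using beta by (simp add: t_0 field_simps)

lemma beta_t_0: "- \<beta> * t 0 = t 0 + \<beta>"
  using beta by (simp add: t_0 field_simps)

lemma t_0_bounds: "- 1 < t 0" "t 0 < - 3/4"
  using beta by (simp_all add: t_0 field_simps)

lemma dom_iff: "x \<in> neg_beta_dom \<beta> \<longleftrightarrow> t 0 \<le> x \<and> x < t 0 + 1"
  unfolding neg_beta_dom_def t_0[symmetric] right_end atLeastLessThan_iff ..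

lemma T_eq:
  assumes "t 0 \<le> y" "y < t 0 + 1" "y = - \<beta> * x - of_int d"
  shows "T x = y"
  using neg_beta_T_eq(1)[of \<beta> x d] assms beta dom_iff by simp

lemma T_t_pow: "(T ^^ m) (t n) = t (n + m)"
proof (induction m)
  case (Suc m)
  have "T (t (n + m)) = t (Suc (n + m))"
    using t_0_bounds t_ge[of "Suc (n + m)"] t_neg[of "Suc (n + m)"]
    by (intro T_eq[OF _ _ t_Suc]) auto
  then show ?case using Suc by simp
qed simp

lemma expansion: "neg_beta_expansion \<beta> (- \<beta> / (\<beta> + 1)) = a"
proof -
  have "neg_beta_expansion \<beta> (- \<beta> / (\<beta> + 1)) !! n = a !! n" for n
  proof -
    have "(T ^^ n) (t 0) = t n"
      using T_t_pow[of n 0] by simp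
    moreover have "\<lfloor>\<beta> / (\<beta> + 1) - \<beta> * t n\<rfloor> = a !! n"
    proof (rule neg_beta_T_eq(2))
      show "- \<beta> * t n - of_int (a !! n) \<in> neg_beta_dom \<beta>"
        unfolding t_Suc[symmetric] dom_iff using t_0_bounds t_ge[of "Suc n"] t_neg[of "Suc n"] by simp
    qed (use beta in simp)
    ultimately show ?thesis
      unfolding neg_beta_expansion_def t_0[symmetric] by simp
  qed
  then show ?thesis
    by (metis smap_alt stream.map_id0 id_apply)
qed

text \<open>While two orbit points have equal digits, one affine branch serves everything between
  them, since their images again bound an interval inside \<open>[t 0, 0)\<close>. Minimum and
  maximum appear because each step reverses orientation.\<close>

lemma T_pow_cylinder:
  assumes "\<And>l. l < m \<Longrightarrow> a !! (i + l) = a !! (j + l)"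
    and x: "min (t i) (t j) \<le> x" "x \<le> max (t i) (t j)"
  shows "(T ^^ m) x = t (i + m) + (- \<beta>) ^ m * (x - t i) \<and>
    min (t (i + m)) (t (j + m)) \<le> (T ^^ m) x \<and> (T ^^ m) x \<le> max (t (i + m)) (t (j + m))"
  using assms(1)
proof (induction m)
  case 0
  then show ?case using x by simp
next
  case (Suc m)
  define y where "y = (T ^^ m) x"
  have y: "y = t (i + m) + (- \<beta>) ^ m * (x - t i)"
    "min (t (i + m)) (t (j + m)) \<le> y" "y \<le> max (t (i + m)) (t (j + m))"
    using Suc by (auto simp: y_def)
  let ?z = "- \<beta> * y - of_int (a !! (i + m))"
  have ti: "t (Suc (i + m)) = - \<beta> * t (i + m) - of_int (a !! (i + m))"
    by (rule t_Suc)
  have tj: "t (Suc (j + m)) = - \<beta> * t (j + m) - of_int (a !! (i + m))"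
    using Suc.prems[of m] by (simp add: t_Suc)
  have z: "min (t (Suc (i + m))) (t (Suc (j + m))) \<le> ?z"
    "?z \<le> max (t (Suc (i + m))) (t (Suc (j + m)))"
    unfolding ti tj using y(2,3) beta by (auto simp: min_def max_def split: if_splits)
  then have "T y = ?z"
    using t_ge[of "Suc (i + m)"] t_ge[of "Suc (j + m)"] t_neg[of "Suc (i + m)"]
      t_neg[of "Suc (j + m)"] t_0_bounds
    by (intro T_eq) (auto simp: min_def max_def split: if_splits)
  moreover have "?z = t (i + Suc m) + (- \<beta>) ^ Suc m * (x - t i)"
    by (simp add: y(1) t_Suc algebra_simps)
  ultimately show ?case
    using z by (simp add: y_def)
qed

text \<open>The last equation compares the suffixes at 0 and \<open>p k + 2\<close>, which share
  \<open>p k\<close> digits: as \<open>p k\<close> is odd, their difference is scaled by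
  \<open>- (\<beta> ^ p k)\<close>.\<close>

lemma t_p:
  "t (p k + 1) = - \<beta> * t (p k) - 1"
  "t (p k + 2) = - \<beta> * t (p k + 1) - 2"
  "t (p (Suc k)) = - \<beta> * t (2 * p k + 2) - 2"
  "\<beta> ^ p k * (t (p k + 2) - t 0) = t (p k) - t (2 * p k + 2)"
proof -
  show "t (p k + 1) = - \<beta> * t (p k) - 1"
    using t_Suc[of "p k"] by (simp add: digits)
  show "t (p k + 2) = - \<beta> * t (p k + 1) - 2"
    using t_Suc[of "p k + 1"] digits(3)[of k] by simp
  show "t (p (Suc k)) = - \<beta> * t (2 * p k + 2) - 2"
    using t_Suc[of "2 * p k + 2"] digits(4)[of k] by (simp add: p_Suc eval_nat_numeral)
  have "(T ^^ p k) (t 0) = t (p k + 2 + p k) + (- \<beta>) ^ p k * (t 0 - t (p k + 2))"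
    using T_pow_cylinder[of "p k" "p k + 2" 0 "t 0"] t_ge[of "p k + 2"] digits(1)[of _ k]
    by auto
  moreover have "t (p k + 2 + p k) = t (2 * p k + 2)"
    by (simp add: mult_2)
  ultimately show "\<beta> ^ p k * (t (p k + 2) - t 0) = t (p k) - t (2 * p k + 2)"
    using T_t_pow[of "p k" 0] by (simp add: right_diff_distrib)
qed

section \<open>Affine pieces of the iterates near the ends of the domain\<close>

text \<open>The digit at position \<open>p k\<close> is 1 and leads to a negative value, which
  forces \<open>t (p k) > - 1/3\<close>. The constant is 3/4 - 1/3.\<close>

lemma t_p_gt: "t 0 + 5/12 < t (p k)"
proof -
  have "\<beta> * t (p k) > - 1"
    using t_p(1)[of k] t_neg[of "p k + 1"] by simp
  then have "t (p k) > - 1 / \<beta>"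
    using beta by (simp add: field_simps)
  moreover have "- 1 / \<beta> > - 1 / 3"
    using beta by (simp add: field_simps)
  ultimately show ?thesis
    using t_0_bounds by simp
qed

text \<open>After \<open>p k\<close> steps come the digit 1 and then 2, or 1 again if 2 would push
  the point below \<open>t 0\<close>; this is the jump. The affine formula for \<open>p k\<close>
  steps is a premise so that the lemma can serve inside the induction that proves this
  formula.\<close>

lemma T_pow_p_2:
  assumes IH: "\<And>e. 0 \<le> e \<Longrightarrow> \<beta> ^ p k * e < t (p k) - t 0 \<Longrightarrow>
      (T ^^ p k) (t 0 + e) = t (p k) - \<beta> ^ p k * e"
    and e: "0 \<le> e" "w = \<beta>\<^sup>2 * \<beta> ^ p k * e" "w < 1"
  shows "w \<le> t (p k + 2) - t 0 \<Longrightarrow> (T ^^ (p k + 2)) (t 0 + e) = t (p k + 2) - w"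
    and "w > t (p k + 2) - t 0 \<Longrightarrow> (T ^^ (p k + 2)) (t 0 + e) = t (p k + 2) + 1 - w"
proof -
  define v where "v = \<beta> ^ p k * e"
  have v: "0 \<le> v" "w = \<beta> * (\<beta> * v)"
    using e beta by (simp_all add: v_def power2_eq_square)
  have v3: "3 * v \<le> \<beta> * v" "3 * (\<beta> * v) \<le> \<beta> * (\<beta> * v)"
    using v beta by (intro mult_right_mono; simp)+
  have 1: "(T ^^ p k) (t 0 + e) = t (p k) - v"
    unfolding v_def using IH[OF e(1)] t_p_gt[of k] v3 v e(3) by (simp add: v_def)
  \<comment> \<open>The image under digit 1 must stay below the right end; multiplied by \<beta>,
    its distance from there is expressed by \<open>t (p k + 2)\<close> and
    \<open>w < 1\<close>.\<close>
  have "\<beta> * (t 0 + 1 - (t (p k + 1) + \<beta> * v)) = 2 + t (p k + 2) - t 0 - w"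
    using t_p(2)[of k] beta_t_0 v by (simp add: algebra_simps)
  also have "\<dots> > 0"
    using t_ge[of "p k + 2"] e(3) by simp
  finally have "t (p k + 1) + \<beta> * v < t 0 + 1"
    using beta by (simp add: zero_less_mult_iff)
  then have 2: "T (t (p k) - v) = t (p k + 1) + \<beta> * v"
    using t_ge[of "p k + 1"] v v3 t_p(1)[of k]
    by (intro T_eq[where d = 1]) (auto simp: algebra_simps)
  have 3: "(T ^^ (p k + 2)) (t 0 + e) = T (t (p k + 1) + \<beta> * v)"
    using 1 2 by simp
  show "(T ^^ (p k + 2)) (t 0 + e) = t (p k + 2) - w" if "w \<le> t (p k + 2) - t 0"
    unfolding 3 using that v v3 t_p(2)[of k] t_neg[of "p k + 2"] t_0_bounds
    by (intro T_eq[where d = 2]) (auto simp: algebra_simps)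
  show "(T ^^ (p k + 2)) (t 0 + e) = t (p k + 2) + 1 - w" if "w > t (p k + 2) - t 0"
    unfolding 3 using that v e(3) t_p(2)[of k] t_ge[of "p k + 2"]
    by (intro T_eq[where d = 1]) (auto simp: algebra_simps)
qed

text \<open>Points right of \<open>t 0\<close> follow its digits as long as the affine image stays
  above \<open>t 0\<close>. The induction traverses \<open>W 1 2 W 2\<close>, the second
  \<open>W\<close> by comparison with the suffix at 0.\<close>

lemma T_pow_p_left_end:
  "0 \<le> e \<Longrightarrow> \<beta> ^ p k * e < t (p k) - t 0 \<Longrightarrow> (T ^^ p k) (t 0 + e) = t (p k) - \<beta> ^ p k * e"
proof (induction k arbitrary: e)
  case 0
  have "shd a = 3"
    using fixed by (simp add: sigma2_fixed_point_def)
  then have "t 1 = - \<beta> * t 0 - 3"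
    using t_Suc[of 0] by simp
  moreover have "0 \<le> \<beta> * e"
    using 0 beta by simp
  ultimately have "T (t 0 + e) = t 1 - \<beta> * e"
    using 0 t_neg[of 1] t_0_bounds
    by (intro T_eq[where d = 3]) (auto simp: p_0 algebra_simps simp del: One_nat_def)
  then show ?case
    by (simp add: p_0)
next
  case (Suc k)
  define b where "b = \<beta> ^ p k"
  define w where "w = \<beta>\<^sup>2 * b * e"
  have b: "b \<ge> 1"
    unfolding b_def using beta by (intro one_le_power) simp
  have z: "\<beta> ^ p (Suc k) * e = \<beta> * (b * w)"
    unfolding power_p_Suc w_def b_def by (simp only: mult_ac power2_eq_square)
  have w: "0 \<le> w"
    using b Suc.prems by (simp add: w_def)
  have bw: "w \<le> b * w" "b * w \<le> \<beta> * (b * w)"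
    using b w beta mult_right_mono[of 1 b w] mult_right_mono[of 1 \<beta> "b * w"] by auto
  have lt: "\<beta> * (b * w) < t (p (Suc k)) - t 0"
    using Suc.prems z by simp
  have "w < 1"
    using bw lt t_neg[of "p (Suc k)"] t_0_bounds by simp
  \<comment> \<open>The digits 1 and 2 that follow the two copies of \<open>W\<close> contribute the
    summand 1, which exceeds \<open>- t 0\<close>; hence the jump is not reached.\<close>
  have "\<beta> * (t (p k) - t (2 * p k + 2)) = 1 + t (p (Suc k)) - t (p k + 1)"
    using t_p(1,3)[of k] by (simp add: algebra_simps)
  then have "\<beta> * (b * w) < \<beta> * (b * (t (p k + 2) - t 0))"
    unfolding b_def t_p(4) using lt t_neg[of "p k + 1"] t_0_bounds by (simp add: b_def)
  then have le: "w \<le> t (p k + 2) - t 0"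
    using beta b by simp
  have 1: "(T ^^ (p k + 2)) (t 0 + e) = t (p k + 2) - w"
    using T_pow_p_2(1)[OF Suc.IH Suc.prems(1) w_def[unfolded b_def] \<open>w < 1\<close> le] .
  have "(T ^^ p k) (t (p k + 2) - w) = t (p k + 2 + p k) + b * w"
    using T_pow_cylinder[of "p k" "p k + 2" 0 "t (p k + 2) - w"] digits(1)[of _ k] w le t_ge[of "p k + 2"]
    by (auto simp: b_def)
  then have 2: "(T ^^ p k) (t (p k + 2) - w) = t (2 * p k + 2) + b * w"
    by (simp add: mult_2 add.commute add.left_commute)
  have 3: "T (t (2 * p k + 2) + b * w) = t (p (Suc k)) - \<beta> * (b * w)"
    using lt bw w t_neg[of "p (Suc k)"] t_0_bounds t_p(3)[of k]
    by (intro T_eq[where d = 2]) (auto simp: algebra_simps)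
  have "p (Suc k) = Suc (p k + (p k + 2))"
    by (simp add: p_Suc)
  then have "(T ^^ p (Suc k)) (t 0 + e) = T ((T ^^ p k) ((T ^^ (p k + 2)) (t 0 + e)))"
    by (simp only: funpow.simps funpow_add o_apply)
  then show ?case
    unfolding z 1 2 3 .
qed

lemma T_pow_p_right_end:
  "0 < e \<Longrightarrow> \<beta> ^ p k * e \<le> real k / (\<beta> * (\<beta> + 1)) \<Longrightarrow> (T ^^ p k) (t 0 + 1 - e) \<noteq> 0"
proof (induction k arbitrary: e)
  \<comment> \<open>The bound on \<open>e\<close> is 0 here, so the claim is vacuous.\<close>
  case 0
  then show ?case
    using beta by (simp add: p_0 mult_le_0_iff)
next
  case (Suc k)
  \<comment> \<open>This is a lower bound, independent of \<open>k\<close>, for the distance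
    \<open>t (p k) - t (2 * p k + 2)\<close>.\<close>
  define \<delta> where "\<delta> = 1 / (\<beta> * (\<beta> + 1))"
  have \<delta>: "0 < \<delta>" "\<beta> * \<delta> = t 0 + 1"
    using beta by (auto simp: \<delta>_def right_end[symmetric])
  have "3 * \<delta> \<le> \<beta> * \<delta>"
    using beta \<delta> by (intro mult_right_mono) auto
  then have "\<delta> < 1"
    using \<delta> t_0_bounds by simp
  define b where "b = \<beta> ^ p k"
  define w where "w = \<beta>\<^sup>2 * b * (\<beta> * e)"
  \<comment> \<open>Together with the bound on \<open>b * w\<close> this gives
    \<open>w \<le> \<delta> < 1\<close>.\<close>
  have b: "b \<ge> real k + 1"
  proof -
    have "real k + 1 \<le> real (p k)"
      using p_gt[of k] by simp
    also have "\<dots> \<le> 2 ^ p k"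
      using of_nat_less_two_power[of "p k", where 'a = real] by simp
    also have "\<dots> \<le> b"
      unfolding b_def using beta by (intro power_mono) auto
    finally show ?thesis .
  qed
  have z: "\<beta> ^ p (Suc k) * e = b * w"
    unfolding power_p_Suc w_def b_def by (simp only: mult_ac power2_eq_square)
  then have bw: "b * w \<le> (real k + 1) * \<delta>"
    using Suc.prems by (simp add: \<delta>_def algebra_simps)
  also have "\<dots> \<le> b * \<delta>"
    using b \<delta> by (intro mult_right_mono) auto
  finally have "w < 1"
    using b \<open>\<delta> < 1\<close> by simp
  have "w > 0"
    using b Suc.prems beta by (simp add: w_def)
  have "1 * (\<beta> * e) \<le> \<beta>\<^sup>2 * b * (\<beta> * e)"
    using b beta Suc.prems mult_mono[of 1 "\<beta>\<^sup>2" 1 b] by (intro mult_right_mono) auto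
  then have "\<beta> * e < 1"
    using \<open>w < 1\<close> by (simp add: w_def)
  then have 1: "T (t 0 + 1 - e) = t 0 + \<beta> * e"
    using Suc.prems beta beta_t_0 by (intro T_eq[where d = 0]) (auto simp: algebra_simps)
  have 2: "(T ^^ p (Suc k)) (t 0 + 1 - e) = (T ^^ p k) ((T ^^ (p k + 2)) (t 0 + \<beta> * e))"
  proof -
    have "p (Suc k) = Suc (p k + (p k + 2))"
      by (simp add: p_Suc)
    then show ?thesis
      by (simp only: funpow_Suc_right funpow_add o_apply 1)
  qed
  have nonneg: "0 \<le> \<beta> * e"
    using Suc.prems beta by simp
  show ?case
  proof (cases "w \<le> t (p k + 2) - t 0")
    case True
    then have "(T ^^ (p k + 2)) (t 0 + \<beta> * e) = t (p k + 2) - w"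
      using T_pow_p_2(1)[OF T_pow_p_left_end nonneg w_def[unfolded b_def] \<open>w < 1\<close>] by simp
    moreover have "(T ^^ p k) (t (p k + 2) - w) < 0"
    proof (rule order.strict_trans1)
      show "(T ^^ p k) (t (p k + 2) - w) \<le> max (t (p k + 2 + p k)) (t (0 + p k))"
        using T_pow_cylinder[of "p k" "p k + 2" 0 "t (p k + 2) - w"] digits(1)[of _ k]
          \<open>w > 0\<close> True t_ge[of "p k + 2"]
        by (auto simp: min_def max_def)
      show "max (t (p k + 2 + p k)) (t (0 + p k)) < 0"
        using t_neg by simp
    qed
    ultimately show ?thesis
      using 2 by simp
  next
    case False
    \<comment> \<open>The distance from the right end after the jump. Scaled by \<open>b\<close>, it
      has lost at least \<delta>, so the bound for \<open>k\<close> applies.\<close>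
    define e' where "e' = w - (t (p k + 2) - t 0)"
    have "(T ^^ (p k + 2)) (t 0 + \<beta> * e) = t 0 + 1 - e'"
      using T_pow_p_2(2)[OF T_pow_p_left_end nonneg w_def[unfolded b_def] \<open>w < 1\<close>] False
      by (simp add: e'_def)
    moreover have "(T ^^ p k) (t 0 + 1 - e') \<noteq> 0"
    proof (rule Suc.IH)
      show "0 < e'"
        using False by (simp add: e'_def)
      have "\<beta> * (t (p k) - t (2 * p k + 2)) = 1 + t (p (Suc k)) - t (p k + 1)"
        using t_p(1,3)[of k] by (simp add: algebra_simps)
      also have "\<dots> \<ge> \<beta> * \<delta>"
        using \<delta> t_ge[of "p (Suc k)"] t_neg[of "p k + 1"] by simp
      finally have "\<delta> \<le> t (p k) - t (2 * p k + 2)"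
        using beta by simp
      moreover have "b * e' = b * w - (t (p k) - t (2 * p k + 2))"
        using t_p(4)[of k] by (simp add: e'_def b_def algebra_simps)
      ultimately have "b * e' \<le> real k * \<delta>"
        using bw by (simp add: distrib_right)
      then show "\<beta> ^ p k * e' \<le> real k / (\<beta> * (\<beta> + 1))"
        by (simp add: b_def \<delta>_def)
    qed
    ultimately show ?thesis
      using 2 by simp
  qed
qed

section \<open>Long gaps between the integers of the base\<close>

text \<open>Representations with different exponents differ by division by a power of
  \<open>- \<beta>\<close>, which the transformation undoes on the open domain. The left end is no
  obstacle, as its orbit is negative and never meets 0.\<close>

lemma neg_beta_integers_imp_T_pow_eq_0:
  assumes "z \<in> neg_beta_integers \<beta>" "z = (- \<beta>) ^ m * y" "t 0 < y" "y < t 0 + 1"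
  shows "(T ^^ m) y = 0"
proof -
  obtain n x where x: "x \<in> neg_beta_dom \<beta>" "(T ^^ n) x = 0" "z = (- \<beta>) ^ n * x"
    using assms(1) by (auto simp: neg_beta_integers_def)
  have "x \<noteq> t 0"
    using x(2) T_t_pow[of n 0] t_neg[of n] by auto
  then have x': "t 0 < x" "x < t 0 + 1"
    using x(1) by (auto simp: dom_iff)
  have shrink: "(T ^^ j) (u / (- \<beta>) ^ j) = u" if "t 0 < u" "u < t 0 + 1" for j u
    using neg_beta_T_pow_divide[of \<beta> u j] that beta by (simp add: t_0 right_end)
  show ?thesis
  proof (cases "n \<le> m")
    case True
    then have "(- \<beta>) ^ m = (- \<beta>) ^ n * (- \<beta>) ^ (m - n)"
      by (simp flip: power_add)
    then have "y = x / (- \<beta>) ^ (m - n)"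
      using assms(2) x(3) beta by (simp add: field_simps)
    then have "(T ^^ (m - n)) y = x"
      using shrink x' by simp
    then show ?thesis
      using x(2) True funpow_add[of n "m - n" T] by simp
  next
    case False
    then have "(- \<beta>) ^ n = (- \<beta>) ^ m * (- \<beta>) ^ (n - m)"
      by (simp flip: power_add)
    then have "x = y / (- \<beta>) ^ (n - m)"
      using assms(2) x(3) beta by (simp add: field_simps)
    then have "(T ^^ (n - m)) x = y"
      using shrink assms(3,4) by simp
    then show ?thesis
      using x(2) False funpow_add[of m "n - m" T] by simp
  qed
qed

lemma not_relatively_dense: "\<not> relatively_dense (neg_beta_integers \<beta>)"
proof
  assume "relatively_dense (neg_beta_integers \<beta>)"
  then obtain R where R: "R > 0" "\<And>x. {x..x + R} \<inter> neg_beta_integers \<beta> \<noteq> {}"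
    unfolding relatively_dense_def by blast
  define \<delta> where "\<delta> = 1 / (\<beta> * (\<beta> + 1))"
  have \<delta>: "0 < \<delta>" "\<delta> < 1"
    using beta less_1_mult[of \<beta> "\<beta> + 1"] by (auto simp: \<delta>_def)
  obtain k where k: "real k * \<delta> > R"
    using \<delta> reals_Archimedean3 by blast
  define b where "b = \<beta> ^ p k"
  \<comment> \<open>An interval of length \<open>R\<close> within the expected gap, which extends
    from \<open>- b * (t 0 + 1)\<close> to the right over a length
    \<open>real k * \<delta> > R\<close>.\<close>
  obtain z where z: "z \<in> neg_beta_integers \<beta>"
    "real k * \<delta> - R - b * (t 0 + 1) \<le> z" "z \<le> real k * \<delta> - b * (t 0 + 1)"
    using R(2)[of "real k * \<delta> - R - b * (t 0 + 1)"] by auto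
  \<comment> \<open>Chosen so that \<open>z\<close> is
    \<open>(- \<beta>) ^ p k * (t 0 + 1 - e)\<close>; the odd exponent turns the right end of the
    domain into the left end of the gap.\<close>
  define e where "e = (z + b * (t 0 + 1)) / b"
  \<comment> \<open>This yields \<open>e < 1\<close>, so \<open>t 0 + 1 - e\<close> lies in the open
    domain.\<close>
  have b: "b > real k" 
  proof -
    have "real k \<le> real (p k)"
      using p_gt[of k] by simp
    also have "\<dots> < 2 ^ p k"
      by simp
    also have "\<dots> \<le> b"
      unfolding b_def using beta by (intro power_mono) auto
    finally show ?thesis .
  qed
  have be: "b * e = z + b * (t 0 + 1)"
    using b by (simp add: e_def)
  have "b * e > 0"
    using z k unfolding be by simp
  then have e: "e > 0"
    using b by (simp add: zero_less_mult_iff)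
  have le: "b * e \<le> real k * \<delta>"
    using z unfolding be by simp
  also have "real k * \<delta> \<le> real k * 1"
    using \<delta> by (intro mult_left_mono) auto
  also have "\<dots> < b * 1"
    using b by simp
  finally have "e < 1"
    using b by simp
  have "z = (- \<beta>) ^ p k * (t 0 + 1 - e)"
    using be by (simp add: b_def algebra_simps)
  then have "(T ^^ p k) (t 0 + 1 - e) = 0"
    using neg_beta_integers_imp_T_pow_eq_0 z(1) e \<open>e < 1\<close> by simp
  moreover have "(T ^^ p k) (t 0 + 1 - e) \<noteq> 0"
    using T_pow_p_right_end[OF e] le by (simp add: b_def \<delta>_def)
  ultimately show False by simp
qed

end

section \<open>Desubstitution and the alternating order\<close>

lemma sdrop_eq_SCons: "sdrop n s = s !! n ## sdrop (Suc n) s"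
  unfolding sdrop_simps(1)[symmetric] sdrop_simps(2)[symmetric] by (rule stream.collapse[symmetric])

text \<open>The lists are the proper suffixes of the images of letters; \<open>n' < n\<close> makes desubstitution
  well-founded.\<close>

lemma sigma2_fixed_point_suffix:
  assumes "sigma2_fixed_point a"
  shows "\<exists>v n'. sdrop n a = v @- morphism_stream sigma2 (sdrop n' a) \<and> n' \<le> n \<and>
    v \<in> {[], [1, 2, 3, 2], [2, 3, 2], [3, 2], [2]} \<and> (v = [] \<longrightarrow> n = 0 \<or> n' < n)"
proof (induction n)
  case 0
  have "sdrop 0 a = [] @- morphism_stream sigma2 (sdrop 0 a)"
    using assms by (simp add: sigma2_fixed_point_def)
  then show ?case
    by blast
next
  case (Suc n)
  then obtain v n' where v: "sdrop n a = v @- morphism_stream sigma2 (sdrop n' a)" "n' \<le> n"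
    "v \<in> {[], [1, 2, 3, 2], [2, 3, 2], [3, 2], [2]}" "v = [] \<longrightarrow> n = 0 \<or> n' < n"
    by blast
  have drop_Suc: "sdrop (Suc n) a = stl (sdrop n a)"
    by (simp only: sdrop_simps)
  show ?case
  proof (cases v)
    case (Cons c u)
    have "sdrop (Suc n) a = u @- morphism_stream sigma2 (sdrop n' a)"
      unfolding drop_Suc v(1) Cons by simp
    moreover have "u \<in> {[], [1, 2, 3, 2], [2, 3, 2], [3, 2], [2]}"
      using v(3) Cons by auto
    ultimately show ?thesis
      using v(2) by (metis le_imp_less_Suc less_imp_le)
  next
    case Nil
    have "sdrop n a = sigma2 (a !! n') @- morphism_stream sigma2 (sdrop (Suc n') a)"
    proof -
      have "sdrop n' a = [a !! n'] @- sdrop (Suc n') a"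
        unfolding shift.simps by (rule sdrop_eq_SCons)
      then have "morphism_stream sigma2 (sdrop n' a) =
          morphism_word sigma2 [a !! n'] @- morphism_stream sigma2 (sdrop (Suc n') a)"
        by (metis morphism_stream_shift sigma2_nonempty)
      then show ?thesis
        unfolding v(1) Nil by (simp add: morphism_word_def del: sdrop.simps)
    qed
    then have eq: "sdrop (Suc n) a = tl (sigma2 (a !! n')) @- morphism_stream sigma2 (sdrop (Suc n') a)"
      unfolding drop_Suc by (simp add: sigma2_def)
    show ?thesis
    proof (cases "a !! n' = 3")
      case True
      then show ?thesis
        using eq v(2) by (intro exI[of _ "[1, 2, 3, 2]"] exI[of _ "Suc n'"]) (simp add: sigma2_def[of 3])
    next
      case False
      \<comment> \<open>Position 0 carries the letter 3, so \<open>n' < n\<close> holds and survives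
        passing to the successors.\<close>
      then have "n \<noteq> 0"
        using v(2) assms by (cases "n = 0") (auto simp: sigma2_fixed_point_def)
      then show ?thesis
        using eq False v(4) Nil by (intro exI[of _ "[]"] exI[of _ "Suc n'"]) (simp add: sigma2_def[of "a !! n'"])
    qed
  qed
qed

text \<open>Larger digits make the value smaller at even 0-based positions and larger at odd ones.\<close>

definition alt_less :: "int stream \<Rightarrow> int stream \<Rightarrow> bool" where
  "alt_less u s \<longleftrightarrow> (\<exists>w x y u' s'. u = w @- y ## u' \<and> s = w @- x ## s' \<and>
     (if even (length w) then x < y else y < x))"

lemma alt_less_morphism_stream_sigma2:
  assumes "alt_less u s"
  shows "alt_less (morphism_stream sigma2 u) (morphism_stream sigma2 s)"
proof -
  obtain w x y u' s' where *: "u = w @- y ## u'" "s = w @- x ## s'"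
    "if even (length w) then x < y else y < x"
    using assms unfolding alt_less_def by blast
  have parity: "even (length (morphism_word sigma2 w)) = even (length w)"
    by (induction w) (auto simp: morphism_word_def sigma2_def)
  have eq: "morphism_stream sigma2 (w @- c ## r) = morphism_word sigma2 w @- c ##
      (tl (sigma2 c) @- morphism_stream sigma2 r)" for c r
    by (simp add: morphism_stream_shift) (simp add: morphism_stream_def sigma2_def)
  show ?thesis
    unfolding alt_less_def *(1,2) eq using *(3) parity by metis
qed

text \<open>A suffix that starts inside the image of 3 is settled by its first two letters against
  31. Any other one is the image of a suffix at a smaller position, where the induction hypothesis
  applies.\<close>

lemma sigma2_fixed_point_least:
  assumes fixed: "sigma2_fixed_point a"
  shows "sdrop n a = a \<or> alt_less a (sdrop n a)"
proof (induction n rule: less_induct)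
  case (less n)
  obtain v n' where v: "sdrop n a = v @- morphism_stream sigma2 (sdrop n' a)"
    "v \<in> {[], [1, 2, 3, 2], [2, 3, 2], [3, 2], [2]}" "v = [] \<longrightarrow> n = 0 \<or> n' < n"
    using sigma2_fixed_point_suffix[OF fixed] by blast
  have a: "morphism_stream sigma2 a = a"
    using fixed by (simp add: sigma2_fixed_point_def)
  obtain r where r: "a = 3 ## 1 ## r"
  proof -
    obtain s where "a = sigma2_pow 1 @- s"
      using sigma2_fixed_point_prefix[OF fixed] by blast
    then show ?thesis
      using that by (simp add: sigma2_pow_Suc[of 0, simplified] morphism_word_def sigma2_def)
  qed
  consider "n = 0" | "v = []" "n' < n" | "v = [3, 2]" | c u where "v = c # u" "c < 3"
    using v(2,3) by auto
  then show ?case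
  proof cases
    case 1
    then show ?thesis by simp
  next
    case 2
    then show ?thesis
      using less[of n'] alt_less_morphism_stream_sigma2[of a "sdrop n' a"] v(1) by (auto simp: a)
  next
    case 3
    \<comment> \<open>The comparison is 31 against 32; at the odd position the smaller digit gives
      the smaller value.\<close>
    have "\<exists>s. sdrop n a = [3] @- 2 ## s"
      using v(1) 3 by simp
    moreover have "a = [3] @- 1 ## r"
      using r by simp
    moreover have "if even (length [3 :: int]) then (2 :: int) < 1 else (1 :: int) < 2"
      by simp
    ultimately have "alt_less a (sdrop n a)"
      unfolding alt_less_def by metis
    then show ?thesis ..
  next
    case (4 c u)
    have "\<exists>s. sdrop n a = [] @- c ## s"
      using v(1) 4 by simp
    moreover have "a = [] @- 3 ## 1 ## r"
      using r by simp
    moreover have "if even (length ([] :: int list)) then c < 3 else 3 < c"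
      using 4 by simp
    ultimately have "alt_less a (sdrop n a)"
      unfolding alt_less_def by metis
    then show ?thesis ..
  qed
qed

section \<open>Values of digit sequences and the choice of the base\<close>

text \<open>The base is \<open>\<beta> = - 1 / x\<close>.\<close>

definition digit_sum :: "real \<Rightarrow> int stream \<Rightarrow> real" where
  "digit_sum x s = x * (\<Sum>i. of_int (s !! i) * x ^ i)"

lemma summable_bounded_digits:
  fixes x :: real and f :: "nat \<Rightarrow> real"
  assumes "\<And>i. \<bar>f i\<bar> \<le> C" "\<bar>x\<bar> < 1"
  shows "summable (\<lambda>i. f i * x ^ i)" "\<bar>\<Sum>i. f i * x ^ i\<bar> \<le> C / (1 - \<bar>x\<bar>)"
proof -
  have sm: "summable (\<lambda>i. C * \<bar>x\<bar> ^ i)"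
    using assms by (intro summable_mult summable_geometric) simp
  have le: "norm (f i * x ^ i) \<le> C * \<bar>x\<bar> ^ i" for i
    using assms by (auto simp: abs_mult power_abs intro!: mult_right_mono)
  show "summable (\<lambda>i. f i * x ^ i)"
    using le by (intro summable_comparison_test[OF _ sm]) auto
  have "\<bar>\<Sum>i. f i * x ^ i\<bar> \<le> (\<Sum>i. C * \<bar>x\<bar> ^ i)"
    using norm_suminf_le[OF le sm] by simp
  also have "\<dots> = C / (1 - \<bar>x\<bar>)"
    using assms by (subst suminf_mult) (auto simp: suminf_geometric summable_geometric)
  finally show "\<bar>\<Sum>i. f i * x ^ i\<bar> \<le> C / (1 - \<bar>x\<bar>)" .
qed

lemma digit_bounds:
  assumes "sset s \<subseteq> {1, 2, 3}"
  shows "1 \<le> s !! i" "s !! i \<le> (3 :: int)"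
proof -
  have "s !! i \<in> {1, 2, 3}"
    using assms snth_sset by blast
  then show "1 \<le> s !! i" "s !! i \<le> 3"
    by auto
qed

lemma summable_digits:
  fixes x :: real
  assumes "sset s \<subseteq> {1, 2, 3 :: int}" "\<bar>x\<bar> < 1"
  shows "summable (\<lambda>i. of_int (s !! i) * x ^ i)"
proof (rule summable_bounded_digits(1)[OF _ assms(2)])
  show "\<bar>of_int (s !! i)\<bar> \<le> (3 :: real)" for i
    using digit_bounds[OF assms(1), of i] by linarith
qed

lemma digit_sum_SCons:
  assumes "sset s \<subseteq> {1, 2, 3}" "\<bar>x\<bar> < 1"
  shows "digit_sum x (c ## s) = x * (of_int c + digit_sum x s)"
proof -
  have "(\<lambda>i. of_int ((c ## s) !! Suc i) * x ^ Suc i) = (\<lambda>i. x * (of_int (s !! i) * x ^ i))"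
    by (simp add: mult_ac fun_eq_iff)
  then have "(\<lambda>i. of_int ((c ## s) !! Suc i) * x ^ Suc i) sums digit_sum x s"
    unfolding digit_sum_def using summable_digits[OF assms] by (simp only: sums_mult summable_sums)
  then have "(\<lambda>i. of_int ((c ## s) !! i) * x ^ i) sums (digit_sum x s + of_int c)"
    using sums_Suc[where f = "\<lambda>i. of_int ((c ## s) !! i) * x ^ i"] by simp
  then show ?thesis
    unfolding digit_sum_def[of x "c ## s"] by (simp add: sums_iff add.commute)
qed

lemma digit_sum_abs_le:
  assumes "sset s \<subseteq> {1, 2, 3}" "\<bar>x\<bar> < 1"
  shows "\<bar>digit_sum x s\<bar> \<le> 3 * \<bar>x\<bar> / (1 - \<bar>x\<bar>)"
proof -
  have "\<bar>of_int (s !! i)\<bar> \<le> (3 :: real)" for i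
    using digit_bounds[OF assms(1), of i] by linarith
  then have "\<bar>\<Sum>i. of_int (s !! i) * x ^ i\<bar> \<le> 3 / (1 - \<bar>x\<bar>)"
    by (rule summable_bounded_digits(2)[OF _ assms(2)])
  then have "\<bar>x\<bar> * \<bar>\<Sum>i. of_int (s !! i) * x ^ i\<bar> \<le> \<bar>x\<bar> * (3 / (1 - \<bar>x\<bar>))"
    by (intro mult_left_mono) auto
  then show ?thesis
    by (simp add: digit_sum_def abs_mult mult.commute)
qed

text \<open>Digits differ by at most 2, and
  \<open>2 * \<bar>x\<bar> / (1 - \<bar>x\<bar>) < 1\<close> means
  \<open>\<bar>x\<bar> < 1/3\<close>. This is the source of the condition
  \<open>\<beta> > 3\<close>.\<close>

lemma digit_sum_diff_less_1:
  assumes "sset s \<subseteq> {1, 2, 3}" "sset u \<subseteq> {1, 2, 3}" "\<bar>x\<bar> < 1/3"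
  shows "\<bar>digit_sum x s - digit_sum x u\<bar> < 1"
proof (cases "x = 0")
  case False
  have x: "\<bar>x\<bar> < 1" using assms by simp
  have "\<bar>of_int (s !! i) - of_int (u !! i)\<bar> \<le> (2 :: real)" for i
    using digit_bounds[OF assms(1), of i] digit_bounds[OF assms(2), of i] by linarith
  then have "\<bar>\<Sum>i. (of_int (s !! i) - of_int (u !! i)) * x ^ i\<bar> \<le> 2 / (1 - \<bar>x\<bar>)"
    by (rule summable_bounded_digits(2)[OF _ x])
  then have "\<bar>x\<bar> * \<bar>\<Sum>i. (of_int (s !! i) - of_int (u !! i)) * x ^ i\<bar> \<le> \<bar>x\<bar> * (2 / (1 - \<bar>x\<bar>))"
    by (intro mult_left_mono) auto
  also have "\<dots> < 1"
    using assms by (simp add: field_simps)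
  also have "(\<Sum>i. (of_int (s !! i) - of_int (u !! i)) * x ^ i) =
      (\<Sum>i. of_int (s !! i) * x ^ i) - (\<Sum>i. of_int (u !! i) * x ^ i)"
    using suminf_diff[OF summable_digits[OF assms(1) x] summable_digits[OF assms(2) x]]
    by (simp add: left_diff_distrib)
  finally show ?thesis
    by (simp add: digit_sum_def abs_mult right_diff_distrib[symmetric])
qed (simp add: digit_sum_def)

text \<open>At the first difference the digits are at least 1 apart, more than the tails can make up
  for. Each common digit in front multiplies by the negative \<open>x\<close> and reverses the
  order.\<close>

lemma digit_sum_less:
  assumes "alt_less u s" "sset u \<subseteq> {1, 2, 3}" "sset s \<subseteq> {1, 2, 3}" "- 1/3 < x" "x < 0"
  shows "digit_sum x u < digit_sum x s"
proof -
  obtain w c d u' s' where *: "u = w @- d ## u'" "s = w @- c ## s'"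
    "if even (length w) then c < d else d < c"
    using assms(1) unfolding alt_less_def by blast
  have x: "\<bar>x\<bar> < 1" using assms by simp
  show ?thesis
    using *(3) assms(2,3) unfolding *(1,2)
  proof (induction w arbitrary: c d u' s')
    case Nil
    then have "\<bar>digit_sum x s' - digit_sum x u'\<bar> < 1"
      using assms by (intro digit_sum_diff_less_1) auto
    moreover have "real_of_int c + 1 \<le> of_int d"
      using Nil by simp
    ultimately show ?case
      using Nil x assms by (simp add: digit_sum_SCons)
  next
    case (Cons e w)
    have "digit_sum x (w @- c ## s') < digit_sum x (w @- d ## u')"
      using Cons.prems by (intro Cons.IH) (auto split: if_splits)
    moreover have "sset (w @- c ## s') \<subseteq> {1, 2, 3}" "sset (w @- d ## u') \<subseteq> {1, 2, 3}"
      using Cons.prems by auto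
    ultimately show ?case
      using x assms by (simp add: digit_sum_SCons del: sset_shift)
  qed
qed

text \<open>With \<open>x = - 1 / \<beta>\<close>, the right-hand side is the left end
  \<open>- \<beta> / (\<beta> + 1)\<close>.\<close>

lemma exists_base_sigma2:
  assumes fixed: "sigma2_fixed_point a"
  shows "\<exists>x. - 1/3 < x \<and> x < 0 \<and> digit_sum x a = 1 / (x - 1)"
proof -
  define F where "F x = digit_sum x a - 1 / (x - 1)" for x
  have a: "sset a \<subseteq> {1, 2, 3}"
    using fixed by (simp add: sigma2_fixed_point_def)
  obtain s where s: "a = 3 ## 1 ## 2 ## s"
  proof -
    obtain s where "a = sigma2_pow 1 @- s"
      using sigma2_fixed_point_prefix[OF fixed] by blast
    then show ?thesis
      using that by (simp add: sigma2_pow_Suc[of 0, simplified] morphism_word_def sigma2_def)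
  qed
  have sset: "sset s \<subseteq> {1, 2, 3}"
    using a s by auto
  have expand: "digit_sum x a = x * (3 + x * (1 + x * (2 + digit_sum x s)))" if "\<bar>x\<bar> < 1" for x
    using that sset by (simp add: s digit_sum_SCons)
  \<comment> \<open>The digits 3, 1, 2 and the crude bound on the remaining tail decide the signs at
    both ends.\<close>
  have "F (- 1/3) < 0"
    using digit_sum_abs_le[OF sset, of "- 1/3"] by (simp add: F_def expand field_simps)
  moreover have "0 < F (- 1/4)"
    using digit_sum_abs_le[OF sset, of "- 1/4"] by (simp add: F_def expand field_simps)
  moreover have "continuous_on {- 1/3..- 1/4} F"
  proof (rule continuous_at_imp_continuous_on, rule ballI)
    fix x :: real assume x: "x \<in> {- 1/3..- 1/4}"
    have "isCont (\<lambda>x. \<Sum>i. of_int (a !! i) * x ^ i) x"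
      using x by (intro isCont_powser[where K = "1/2"] summable_digits[OF a]) auto
    then show "isCont F x"
      unfolding F_def digit_sum_def using x by (intro continuous_intros) auto
  qed
  ultimately obtain x where x: "- 1/3 \<le> x" "x \<le> - 1/4" "F x = 0"
    using IVT'[of F "- 1/3" 0 "- 1/4"] by auto
  moreover have "x \<noteq> - 1/3"
    using x(3) \<open>F (- 1/3) < 0\<close> by auto
  ultimately show ?thesis
    by (intro exI[of _ x]) (auto simp: F_def)
qed

theorem proposition5:
  fixes a :: "int stream"
  assumes "sigma2_fixed_point a"
  shows "\<exists>\<beta>>1. neg_beta_expansion \<beta> (- \<beta> / (\<beta> + 1)) = a \<and>
           \<not> relatively_dense (neg_beta_integers \<beta>)"
proof -
  obtain x where x: "- 1/3 < x" "x < 0" "digit_sum x a = 1 / (x - 1)"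
    using exists_base_sigma2[OF assms] by blast
  define \<beta> where "\<beta> = - 1 / x"
  define t where "t n = digit_sum x (sdrop n a)" for n
  have beta: "\<beta> > 3" and x_eq: "x = - 1 / \<beta>"
    using x by (auto simp: \<beta>_def field_simps)
  have a: "sset a \<subseteq> {1, 2, 3}"
    using assms by (simp add: sigma2_fixed_point_def)
  have drop: "sset (sdrop n a) \<subseteq> {1, 2, 3}" for n
    using a by (metis Un_upper2 sset_shift stake_sdrop subset_trans)
  have t_0: "t 0 = - \<beta> / (\<beta> + 1)"
    using x beta by (simp add: t_def x_eq field_simps)
  have t: "t n = x * (of_int (a !! n) + t (Suc n))" for n
    unfolding t_def sdrop_eq_SCons[of n] using x by (intro digit_sum_SCons drop) auto
  have t_ge: "t 0 \<le> t n" for n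
    using sigma2_fixed_point_least[OF assms, of n] digit_sum_less[OF _ a drop x(1,2)]
    by (auto simp: t_def less_imp_le)
  have "t n < 0" for n
  proof -
    \<comment> \<open>A digit is at least 1 and the next value exceeds -1, so their sum is positive
      and the factor \<open>x\<close> makes it negative.\<close>
    have "- 1 < t 0"
      unfolding t_0 using beta by (simp add: field_simps)
    moreover have "1 \<le> a !! n"
      using digit_bounds[OF a] by simp
    ultimately have "of_int (a !! n) + t (Suc n) > 0"
      using t_ge[of "Suc n"] by linarith
    then show ?thesis
      unfolding t[of n] using x by (simp add: mult_neg_pos)
  qed
  moreover have "t (Suc n) = - \<beta> * t n - of_int (a !! n)" for n
    using t[of n] beta by (simp add: x_eq field_simps)
  ultimately interpret sigma2_orbit \<beta> a t
    using beta assms t_0 t_ge by unfold_locales auto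
  show ?thesis
    using beta expansion not_relatively_dense by (intro exI[of _ \<beta>]) auto
qed

end
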